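(* Let $t_0>0$, $\sigma\ge0$, $\mu>0$, $0\le\tau\le\alpha\le3$ with $\alpha>0$, $\delta=\frac3{2\alpha+\tau}$, and $\beta(t)=\mu t^\tau$. Let $\epsilon:[t_0,+\infty)\to\mathcal H_1$ satisfy $\int_{t_0}^{+\infty}t^{(\alpha-\tau)/3}\|\epsilon(t)\|\,dt<+\infty$. Let $(x(t),\lambda(t))$ be a global solution on $[t_0,+\infty)$ of $$\begin{cases}\ddot x(t)+\frac{\alpha}{t}\dot x(t)=-\beta(t)\big(\nabla f(x(t))+A^T(\lambda(t)+\delta t\dot\lambda(t))+\sigma A^T(Ax(t)-b)\big)+\epsilon(t),\\ \ddot\lambda(t)+\frac{\alpha}{t}\dot\lambda(t)=\beta(t)\big(A(x(t)+\delta t\dot x(t))-b\big).\end{cases}$$ Then for any $(x^*,\lambda^* )\in\Omega$, $$|f(x(t))-f(x^* )|=\mathcal O\Big(\frac1{t^{(2\alpha+\tau)/3}}\Big),\qquad \|Ax(t)-b\|=\mathcal O\Big(\frac1{t^{(2\alpha+\tau)/3}}\Big).$$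
   Context: $\mathcal H_1,\mathcal H_2$ are real Hilbert spaces, $A:\mathcal H_1\to\mathcal H_2$ is a continuous linear operator with adjoint $A^T$, $b\in\mathcal H_2$, and $f:\mathcal H_1\to\mathbb R$ is convex and continuously differentiable. $\Omega\subset\mathcal H_1\times\mathcal H_2$ is the set of saddle points of the Lagrangian $\mathcal L(x,\lambda)=f(x)+\langle\lambda,Ax-b\rangle$, equivalently the set of pairs $(x^*,\lambda^* )$ with $\nabla f(x^* )=-A^T\lambda^*$ and $Ax^*=b$; it is assumed nonempty. A global solution of the system is a pair $(x,\lambda)$ with $x\in\mathcal C^2([t_0,+\infty),\mathcal H_1)$, $\lambda\in\mathcal C^2([t_0,+\infty),\mathcal H_2)$, such that $(x,\lambda)$ and $(\dot x,\dot\lambda)$ are locally absolutely continuous and the system holds for almost every $t\ge t_0$. All $\mathcal O(\cdot)$ are as $t\to+\infty$. *)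

theory Defs
  imports "HOL-Analysis.Analysis" "HOL-Library.Landau_Symbols"
begin

definition lagrangian ::
  "('a::real_inner \<Rightarrow> real) \<Rightarrow> ('a \<Rightarrow> 'b::real_inner) \<Rightarrow> 'b \<Rightarrow> 'a \<Rightarrow> 'b \<Rightarrow> real"
where
  "lagrangian f A b x lam = f x + lam \<bullet> (A x - b)"

definition saddle_points ::
  "('a::real_inner \<Rightarrow> real) \<Rightarrow> ('a \<Rightarrow> 'b::real_inner) \<Rightarrow> 'b \<Rightarrow> ('a \<times> 'b) set"
where
  "saddle_points f A b =
     {(xs, ls). \<forall>x lam. lagrangian f A b xs lam \<le> lagrangian f A b xs ls \<and>
                        lagrangian f A b xs ls \<le> lagrangian f A b x ls}"

definition abs_cont_interval :: "real \<Rightarrow> real \<Rightarrow> (real \<Rightarrow> 'a::real_normed_vector) \<Rightarrow> bool"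
where
  "abs_cont_interval a b g \<longleftrightarrow>
     (\<forall>e>0. \<exists>d>0. \<forall>(n::nat) (l::nat \<Rightarrow> real) u.
        (\<forall>i<n. a \<le> l i \<and> l i \<le> u i \<and> u i \<le> b) \<and>
        (\<forall>i<n. \<forall>j<n. i \<noteq> j \<longrightarrow> {l i<..<u i} \<inter> {l j<..<u j} = {}) \<and>
        (\<Sum>i<n. u i - l i) < d \<longrightarrow>
        (\<Sum>i<n. norm (g (u i) - g (l i))) < e)"

definition locally_abs_cont_from :: "real \<Rightarrow> (real \<Rightarrow> 'a::real_normed_vector) \<Rightarrow> bool"
where
  "locally_abs_cont_from t0 g \<longleftrightarrow> (\<forall>a b. t0 \<le> a \<and> a \<le> b \<longrightarrow> abs_cont_interval a b g)"

(* g is twice continuously differentiable on S with derivatives g' and g''; at boundary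
   points of S the derivatives are one-sided. *)
definition C2_on_with ::
  "real set \<Rightarrow> (real \<Rightarrow> 'a::real_normed_vector) \<Rightarrow> (real \<Rightarrow> 'a) \<Rightarrow> (real \<Rightarrow> 'a) \<Rightarrow> bool"
where
  "C2_on_with S g g' g'' \<longleftrightarrow>
     (\<forall>t\<in>S. (g has_vector_derivative g' t) (at t within S)) \<and>
     (\<forall>t\<in>S. (g' has_vector_derivative g'' t) (at t within S)) \<and>
     continuous_on S g''"

(* The argument gradf is the gradient of the objective function. *)
definition global_solution ::
  "real \<Rightarrow> real \<Rightarrow> real \<Rightarrow> real \<Rightarrow> (real \<Rightarrow> real) \<Rightarrow>
   ('a::real_inner \<Rightarrow> 'a) \<Rightarrow> ('a \<Rightarrow> 'b::real_inner) \<Rightarrow> 'b \<Rightarrow> (real \<Rightarrow> 'a) \<Rightarrow>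
   (real \<Rightarrow> 'a) \<Rightarrow> (real \<Rightarrow> 'b) \<Rightarrow> bool"
where
  "global_solution t0 \<alpha> \<delta> \<sigma> \<beta> gradf A b \<epsilon> x lam \<longleftrightarrow>
     (\<exists>x' x'' lam' lam''.
        C2_on_with {t0..} x x' x'' \<and>
        C2_on_with {t0..} lam lam' lam'' \<and>
        locally_abs_cont_from t0 (\<lambda>t. (x t, lam t)) \<and>
        locally_abs_cont_from t0 (\<lambda>t. (x' t, lam' t)) \<and>
        (AE t in lebesgue_on {t0..}.
           x'' t + (\<alpha> / t) *\<^sub>R x' t =
             - (\<beta> t *\<^sub>R (gradf (x t) + adjoint A (lam t + (\<delta> * t) *\<^sub>R lam' t)
                 + \<sigma> *\<^sub>R adjoint A (A (x t) - b))) + \<epsilon> t \<and>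
           lam'' t + (\<alpha> / t) *\<^sub>R lam' t = \<beta> t *\<^sub>R (A (x t + (\<delta> * t) *\<^sub>R x' t) - b)))"

end

theory Submission
  imports Defs
begin

text \<open>
  Put \<open>p = (\<alpha> - \<tau>) / 3\<close> and \<open>\<gamma> = 1 / \<delta> = (2 * \<alpha> + \<tau>) / 3\<close>, so that \<open>\<alpha> = p + \<gamma>\<close> and \<open>\<tau> = \<gamma> - 2 * p\<close>.
  For a saddle point let \<open>u = x - x\<^sup>*\<close> and \<open>v = \<lambda> - \<lambda>\<^sup>*\<close>. The energy adds \<open>\<mu> t\<^sup>\<gamma>\<close> times the augmented Lagrangian gap
  to \<open>t\<^bsup>2p-2\<^esup> (|\<gamma>u + tu'|\<^sup>2 + (1 - p) \<gamma> |u|\<^sup>2) / 2\<close> and the same expression in \<open>v\<close>. The extrapolation \<open>\<delta> t\<close>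
  makes the coupling terms cancel, convexity handles the gap, and the derivative of the energy \<open>E\<close> is at most
  \<open>t\<^sup>p |\<epsilon>| sqrt (2E)\<close>; hence \<open>E\<close> is bounded and the Lagrangian gap decays at rate \<open>\<gamma>\<close>. The dual equation then
  shows that \<open>(\<mu> / \<gamma>) t\<^sup>\<gamma> Au - t\<^bsup>2p-2\<^esup> ((\<gamma> + 1 - p) v + t v')\<close> has derivative
  \<open>2 (1 - p) (\<gamma> + 1 - p) t\<^bsup>2p-3\<^esup> v\<close>, whose norm the energy bound dominates by a multiple of
  \<open>(1 - p) t\<^bsup>p-2\<^esup>\<close>. So \<open>t\<^sup>\<gamma> |Au|\<close> is bounded, and with the gap this bounds \<open>|f(x) - f(x\<^sup>*)|\<close>.
\<close>

section \<open>Riesz representation and the adjoint on a Hilbert space\<close>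

text \<open>The representing vector is the minimiser of the quadratic functional
  \<open>J x = (norm x)\<^sup>2 / 2 - \<phi> x\<close>. Completeness supplies the minimiser as limit
  of a minimising sequence, and the vanishing of its first variation is the representation.\<close>

lemma Riesz_representation:
  fixes \<phi> :: "'a::{real_inner, complete_space} \<Rightarrow> real"
  assumes "bounded_linear \<phi>"
  shows "\<exists>z. \<forall>x. \<phi> x = z \<bullet> x"
proof -
  interpret \<phi>: bounded_linear \<phi> by fact
  define J where "J x = (norm x)\<^sup>2 / 2 - \<phi> x" for x
  obtain K where K: "\<And>x. norm (\<phi> x) \<le> norm x * K"
    using \<phi>.bounded by blast
  have low: "J x \<ge> - (K\<^sup>2 / 2)" for x
  proof -
    have "\<phi> x \<le> norm x * K" using K[of x] by simp
    moreover have "0 \<le> (norm x - K)\<^sup>2" by simp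
    ultimately show ?thesis
      by (simp add: J_def power2_diff)
  qed
  then have bdd: "bdd_below (range J)" by (meson bdd_belowI2)
  define d where "d = Inf (range J)"
  have d_le: "d \<le> J x" for x unfolding d_def using bdd by (simp add: cInf_lower)
  have "\<exists>x. J x < d + 1 / real (Suc n)" for n
    using cInf_lessD[of "range J" "d + 1 / real (Suc n)"] unfolding d_def by auto
  then obtain X where X: "\<And>n. J (X n) < d + 1 / real (Suc n)" by metis
  \<comment> \<open>Parallelogram law: the linear part \<open>\<phi>\<close> cancels, so two
    near-minimisers of \<open>J\<close> must be close, because \<open>J\<close> at their midpoint is
    at least \<open>d\<close>. This makes \<open>X\<close> a Cauchy sequence.\<close>
  have par: "(norm (x - y))\<^sup>2 = 4 * (J x + J y - 2 * J ((1/2) *\<^sub>R (x + y)))" for x y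
    unfolding J_def \<phi>.scale \<phi>.add power2_norm_eq_inner
    by (simp add: inner_simps inner_commute field_simps)
  have bnd: "(norm (X m - X n))\<^sup>2 \<le> 4 * (1 / real (Suc m) + 1 / real (Suc n))" for m n
    unfolding par using X[of m] X[of n] d_le[of "(1/2) *\<^sub>R (X m + X n)"] by argo
  have "Cauchy X"
  proof (rule CauchyI)
    fix e :: real assume e: "e > 0"
    obtain M where M: "1 / real (Suc M) < e\<^sup>2 / 8"
      using e nat_approx_posE[of "e\<^sup>2 / 8"] by auto
    show "\<exists>M. \<forall>m\<ge>M. \<forall>n\<ge>M. norm (X m - X n) < e"
    proof (intro exI allI impI)
      fix m n assume "M \<le> m" "M \<le> n"
      then have "1 / real (Suc m) \<le> 1 / real (Suc M)" "1 / real (Suc n) \<le> 1 / real (Suc M)"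
        by (auto simp: field_simps)
      then have "(norm (X m - X n))\<^sup>2 < e\<^sup>2" using bnd[of m n] M by argo
      then show "norm (X m - X n) < e" using e by (meson less_imp_le power_less_imp_less_base)
    qed
  qed
  then obtain z where z: "X \<longlonglongrightarrow> z" by (auto simp: Cauchy_convergent_iff convergent_def)
  have "(\<lambda>n. J (X n)) \<longlonglongrightarrow> J z"
    unfolding J_def by (intro tendsto_intros \<phi>.tendsto z) simp
  moreover have "(\<lambda>n. d + 1 / real (Suc n)) \<longlonglongrightarrow> d"
    using LIMSEQ_inverse_real_of_nat_add[of d] by (simp add: inverse_eq_divide)
  ultimately have "J z \<le> d" using X by (meson LIMSEQ_le less_imp_le)
  then have min: "J z \<le> J x" for x using d_le[of x] by linarith
  have "\<phi> x = z \<bullet> x" for x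
  proof (cases "x = 0")
    case False
    define c where "c = z \<bullet> x - \<phi> x"
    \<comment> \<open>This step length minimises
      \<open>s * c + s\<^sup>2 * (x \<bullet> x) / 2\<close>. The minimum is negative unless
      \<open>c = 0\<close>, which would contradict the minimality of \<open>z\<close>.\<close>
    define s where "s = - c / (x \<bullet> x)"
    have xx: "x \<bullet> x > 0" using False by simp
    have "J (z + s *\<^sub>R x) - J z = s * c + s\<^sup>2 * (x \<bullet> x) / 2"
      unfolding J_def c_def \<phi>.scale \<phi>.add power2_norm_eq_inner
      by (simp add: inner_simps inner_commute algebra_simps power2_eq_square)
    also have "\<dots> = - c\<^sup>2 / (2 * (x \<bullet> x))"
      using xx by (simp add: s_def field_simps power2_eq_square)
    finally have "0 \<le> - c\<^sup>2 / (2 * (x \<bullet> x))" using min[of "z + s *\<^sub>R x"] by linarith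
    then have "c\<^sup>2 \<le> 0" using xx by (simp add: field_simps zero_le_divide_iff)
    then show ?thesis by (simp add: c_def)
  qed (simp add: \<phi>.zero)
  then show ?thesis by blast
qed

text \<open>\<open>adjoint\<close> is obtained by choice, so its defining identity is available only
  once some adjoint exists. Riesz applied to \<open>\<lambda>x. A x \<bullet> y\<close> for each
  \<open>y\<close> provides one.\<close>

lemma adjoint_inner:
  fixes A :: "'a::{real_inner, complete_space} \<Rightarrow> 'b::real_inner"
  assumes "bounded_linear A"
  shows "A x \<bullet> y = x \<bullet> adjoint A y"
proof -
  have "\<forall>y. \<exists>w. \<forall>x. A x \<bullet> y = x \<bullet> w"
    using Riesz_representation[OF bounded_linear_compose[OF bounded_linear_inner_left assms]]
    by (metis inner_commute)
  then obtain g where "\<forall>x y. A x \<bullet> y = x \<bullet> g y" by metis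
  then show ?thesis using adjoint_unique by metis
qed

text \<open>Linearity holds since inner products determine a vector. For the bound, pair
  \<open>adjoint A y\<close> with itself, move \<open>A\<close> across and cancel one factor
  \<open>norm (adjoint A y)\<close>. The result serves the continuity of the forcing term in the
  final proof.\<close>

lemma bounded_linear_adjoint:
  fixes A :: "'a::{real_inner, complete_space} \<Rightarrow> 'b::real_inner"
  assumes A: "bounded_linear A"
  shows "bounded_linear (adjoint A)"
proof -
  note adj = adjoint_inner[OF A, symmetric]
  obtain K where K: "K > 0" "\<And>x. norm (A x) \<le> norm x * K"
    using bounded_linear.pos_bounded[OF A] by blast
  show ?thesis
  proof (rule bounded_linear_intro)
    fix y z r
    show "adjoint A (y + z) = adjoint A y + adjoint A z"
      by (rule vector_eq_rdot[THEN iffD1]) (metis adj inner_add_right inner_commute)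
    show "adjoint A (r *\<^sub>R y) = r *\<^sub>R adjoint A y"
      by (rule vector_eq_rdot[THEN iffD1]) (metis adj inner_scaleR_right inner_commute)
    have "(norm (adjoint A y))\<^sup>2 = A (adjoint A y) \<bullet> y"
      by (simp add: adj[symmetric] power2_norm_eq_inner adjoint_inner[OF A])
    also have "\<dots> \<le> norm (adjoint A y) * K * norm y"
      by (meson K(2) mult_right_mono norm_cauchy_schwarz norm_ge_zero order_trans)
    finally have "norm (adjoint A y) * norm (adjoint A y) \<le> norm (adjoint A y) * (norm y * K)"
      by (simp add: power2_eq_square mult_ac)
    then show "norm (adjoint A y) \<le> norm y * K"
      using K(1) by (cases "norm (adjoint A y) = 0") (auto simp: mult_le_cancel_left)
  qed
qed

section \<open>Tangent inequality, almost everywhere equality and a Gronwall-type bound\<close>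

text \<open>Restricting \<open>f\<close> to the line through \<open>x\<close> and \<open>y\<close>
  reduces the claim to the tangent inequality for a convex function of one real variable.\<close>

lemma convex_on_GDERIV_le:
  fixes f :: "'a::real_inner \<Rightarrow> real"
  assumes f: "convex_on UNIV f" and g: "GDERIV f x :> g"
  shows "f x + (y - x) \<bullet> g \<le> f y"
proof -
  define \<phi> where "\<phi> s = f (x + s *\<^sub>R (y - x))" for s
  have "convex_on UNIV \<phi>"
  proof (rule convex_onI)
    fix t r s :: real assume "0 < t" "t < 1"
    have "x + ((1 - t) *\<^sub>R r + t *\<^sub>R s) *\<^sub>R (y - x)
        = (1 - t) *\<^sub>R (x + r *\<^sub>R (y - x)) + t *\<^sub>R (x + s *\<^sub>R (y - x))"
      by (simp add: algebra_simps)
    then show "\<phi> ((1 - t) *\<^sub>R r + t *\<^sub>R s) \<le> (1 - t) * \<phi> r + t * \<phi> s"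
      unfolding \<phi>_def using convex_onD[OF f] \<open>0 < t\<close> \<open>t < 1\<close> by simp
  qed simp
  moreover have "(\<phi> has_derivative (\<lambda>h. (h *\<^sub>R (y - x)) \<bullet> g)) (at 0)"
    unfolding \<phi>_def
    by (rule has_derivative_compose[of "\<lambda>s. x + s *\<^sub>R (y - x)"])
       (use g in \<open>auto intro!: derivative_eq_intros simp: gderiv_def\<close>)
  then have "(\<phi> has_field_derivative (y - x) \<bullet> g) (at 0)"
    unfolding has_field_derivative_def by (simp add: mult.commute[of _ "(y - x) \<bullet> g"])
  ultimately have "((y - x) \<bullet> g) * (1 - 0) \<le> \<phi> 1 - \<phi> 0"
    by (intro convex_on_imp_above_tangent[of UNIV]) auto
  then show ?thesis by (simp add: \<phi>_def)
qed

text \<open>If the two values differed at one point, then by continuity and Hausdorff separation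
  they would differ on a nonempty open set, which is never negligible. This upgrades an equation
  valid almost everywhere to one valid everywhere.\<close>

lemma AE_eq_continuous_on_open:
  fixes f g :: "'a::euclidean_space \<Rightarrow> 'b::t2_space"
  assumes ae: "AE t in lebesgue. t \<in> S \<longrightarrow> f t = g t"
    and S: "open S" and f: "continuous_on S f" and g: "continuous_on S g" and t: "t \<in> S"
  shows "f t = g t"
proof (rule ccontr)
  assume ne: "f t \<noteq> g t"
  define U where "U = {s \<in> S. f s \<noteq> g s}"
  obtain V W where VW: "open V" "open W" "f t \<in> V" "g t \<in> W" "V \<inter> W = {}"
    using hausdorff[OF ne] by blast
  define N where "N = (S \<inter> f -` V) \<inter> (S \<inter> g -` W)"
  have "open N" unfolding N_def
    using f g S VW by (intro open_Int continuous_open_preimage)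
  moreover have "t \<in> N" using VW t by (auto simp: N_def)
  moreover have "negligible N"
  proof -
    obtain M where "negligible M" "{t. \<not> (t \<in> S \<longrightarrow> f t = g t)} \<subseteq> M"
      using ae unfolding eventually_ae_filter_negligible by blast
    moreover have "N \<subseteq> {t. \<not> (t \<in> S \<longrightarrow> f t = g t)}" using VW by (auto simp: N_def)
    ultimately show ?thesis by (meson negligible_subset order_trans)
  qed
  ultimately show False using open_not_negligible by blast
qed

text \<open>The derivative of \<open>sqrt (2 * E t + 1)\<close> is
  \<open>E' t / sqrt (2 * E t + 1)\<close>, hence at most \<open>h t\<close>, so this root grows by
  no more than the total integral of \<open>h\<close>. The summand 1 keeps the root differentiable
  where \<open>E\<close> vanishes.\<close>

lemma bounded_of_deriv_le_sqrt:
  fixes E :: "real \<Rightarrow> real"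
  assumes E0: "\<And>t. t \<ge> T \<Longrightarrow> 0 \<le> E t"
    and E': "\<And>t. t \<ge> T \<Longrightarrow> (E has_real_derivative E' t) (at t)"
    and le: "\<And>t. t \<ge> T \<Longrightarrow> E' t \<le> h t * sqrt (2 * E t)"
    and h: "continuous_on {T..} h" "\<And>t. t \<ge> T \<Longrightarrow> 0 \<le> h t" "h integrable_on {T..}"
  shows "\<exists>K. \<forall>t\<ge>T. E t \<le> K"
proof -
  define I where "I = integral {T..} h"
  have main: "sqrt (2 * E t + 1) \<le> sqrt (2 * E T + 1) + I" if t: "t \<ge> T" for t
  proof -
    define F where "F s = integral {T..s} h" for s
    have cont: "continuous_on {T..t} h" using h(1) by (rule continuous_on_subset) auto
    have F': "(F has_real_derivative h s) (at s)" if "T < s" "s < t" for s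
      using integral_has_real_derivative[OF cont, of s] that
        at_within_Icc_at[of T s t] by (simp add: F_def[abs_def])
    have "continuous_on {T..t} F"
      unfolding F_def by (intro indefinite_integral_continuous_1 integrable_continuous_real cont)
    moreover have "continuous_on {T..t} E"
      using E' by (intro DERIV_continuous_on[of _ E E']) (auto intro: has_field_derivative_at_within)
    ultimately have "sqrt (2 * E t + 1) - F t \<le> sqrt (2 * E T + 1) - F T"
    proof (intro DERIV_nonpos_imp_decreasing_open[OF t] continuous_intros)
      fix s assume s: "T < s" "s < t"
      then have sT: "s \<ge> T" by simp
      have pos: "2 * E s + 1 > 0" using E0[OF sT] by simp
      have "((\<lambda>s. sqrt (2 * E s + 1) - F s) has_real_derivative E' s / sqrt (2 * E s + 1) - h s) (at s)"
        by (rule derivative_eq_intros E'[OF sT] F' s refl | use pos in \<open>simp add: field_simps\<close>)+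
      moreover have "h s * sqrt (2 * E s) \<le> h s * sqrt (2 * E s + 1)"
        using h(2)[OF sT] by (intro mult_left_mono) auto
      then have "E' s / sqrt (2 * E s + 1) - h s \<le> 0"
        using le[OF sT] pos by (simp add: field_simps)
      ultimately show "\<exists>y. ((\<lambda>s. sqrt (2 * E s + 1) - F s) has_real_derivative y) (at s) \<and> y \<le> 0"
        by blast
    qed
    moreover have "F t \<le> I" unfolding F_def I_def
      using h by (intro integral_subset_le integrable_continuous_real cont) auto
    moreover have "F T = 0" by (simp add: F_def)
    ultimately show ?thesis by linarith
  qed
  have "E t \<le> (sqrt (2 * E T + 1) + I)\<^sup>2" if t: "t \<ge> T" for t
  proof -
    have "2 * E t + 1 \<le> (sqrt (2 * E T + 1) + I)\<^sup>2"
      using main[OF t] E0[OF t] sqrt_le_D by blast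
    then show ?thesis using E0[OF t] by linarith
  qed
  then show ?thesis by blast
qed

section \<open>Differentiation of the quadratic part of the energy\<close>

lemma has_real_derivative_norm_power2:
  fixes y :: "real \<Rightarrow> 'a::real_inner"
  assumes "(y has_vector_derivative y') (at t)"
  shows "((\<lambda>s. (norm (y s))\<^sup>2) has_real_derivative 2 * (y t \<bullet> y')) (at t)"
  using has_derivative_inner[OF assms[unfolded has_vector_derivative_def] assms[unfolded has_vector_derivative_def]]
  unfolding power2_norm_eq_inner has_field_derivative_def
  by (rule has_derivative_eq_rhs) (auto simp: inner_commute algebra_simps fun_eq_iff)

text \<open>By the damped equation, \<open>\<gamma> *\<^sub>R u + t *\<^sub>R u'\<close> has
  derivative \<open>(1 - p) *\<^sub>R u' + t *\<^sub>R g\<close>. With the weight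
  \<open>t powr (2 * p - 2)\<close> the terms in \<open>(norm u')\<^sup>2\<close> cancel, and the
  coefficient \<open>(1 - p) * \<gamma>\<close> is the one that removes the mixed term
  \<open>u \<bullet> u'\<close>. What is left besides \<open>g\<close> is nonpositive when p \<le> 1
  and \<gamma> > 0.\<close>

lemma damped_energy_derivative:
  fixes u :: "real \<Rightarrow> 'a::real_inner"
  assumes t: "t > 0"
    and u: "(u has_vector_derivative u' t) (at t)"
    and u': "(u' has_vector_derivative u'') (at t)"
    and u'': "u'' = - ((p + \<gamma>) / t) *\<^sub>R u' t + g"
  shows "((\<lambda>s. s powr (2 * p - 2) * ((norm (\<gamma> *\<^sub>R u s + s *\<^sub>R u' s))\<^sup>2 / 2
              + (1 - p) * \<gamma> / 2 * (norm (u s))\<^sup>2)) has_real_derivative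
            (t powr (2 * p - 1) * ((\<gamma> *\<^sub>R u t + t *\<^sub>R u' t) \<bullet> g)
              - (1 - p) * \<gamma> * (\<gamma> + 1 - p) * t powr (2 * p - 3) * (norm (u t))\<^sup>2)) (at t)"
proof -
  \<comment> \<open>Expressing every power of \<open>t\<close> as \<open>P\<close> times an integral
    power leaves a polynomial identity.\<close>
  define P where "P = t powr (2 * p - 3)"
  have P: "t powr (2 * p - 3) = P" "t powr (2 * p - 2) = t * P" "t powr (2 * p - 1) = t * (t * P)"
    using t powr_mult_base[of t "2 * p - 3"] powr_mult_base[of t "2 * p - 2"] by (simp_all add: P_def)
  note nd = has_real_derivative_norm_power2
  have w: "((\<lambda>s. \<gamma> *\<^sub>R u s + s *\<^sub>R u' s) has_vector_derivative \<gamma> *\<^sub>R u' t + (u' t + t *\<^sub>R u'')) (at t)"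
    using u u' unfolding has_vector_derivative_def
    by (auto intro!: derivative_eq_intros simp: algebra_simps fun_eq_iff)
  have tu'': "t *\<^sub>R u'' = - (p + \<gamma>) *\<^sub>R u' t + t *\<^sub>R g"
  proof -
    have "t * - ((p + \<gamma>) / t) = - (p + \<gamma>)" using t by simp
    then show ?thesis by (simp only: u'' scaleR_add_right scaleR_scaleR)
  qed
  have "((\<lambda>s. s powr (2 * p - 2) * ((norm (\<gamma> *\<^sub>R u s + s *\<^sub>R u' s))\<^sup>2 / 2
              + (1 - p) * \<gamma> / 2 * (norm (u s))\<^sup>2)) has_real_derivative
         (2 * p - 2) * t powr (2 * p - 2 - 1) * ((norm (\<gamma> *\<^sub>R u t + t *\<^sub>R u' t))\<^sup>2 / 2
              + (1 - p) * \<gamma> / 2 * (norm (u t))\<^sup>2)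
         + (2 * ((\<gamma> *\<^sub>R u t + t *\<^sub>R u' t) \<bullet> (\<gamma> *\<^sub>R u' t + (u' t + t *\<^sub>R u''))) / 2
             + (1 - p) * \<gamma> / 2 * (2 * (u t \<bullet> u' t))) * t powr (2 * p - 2)) (at t)"
    by (intro DERIV_mult has_real_derivative_powr t DERIV_add DERIV_cdivide DERIV_cmult nd[OF w] nd[OF u])
  then show ?thesis
    unfolding power2_norm_eq_inner
  proof (rule DERIV_cong)
    have P1: "t powr (2 * p - 2 - 1) = P" by (simp add: P_def)
    show "(2 * p - 2) * t powr (2 * p - 2 - 1) * (((\<gamma> *\<^sub>R u t + t *\<^sub>R u' t) \<bullet> (\<gamma> *\<^sub>R u t + t *\<^sub>R u' t)) / 2
              + (1 - p) * \<gamma> / 2 * (u t \<bullet> u t))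
         + (2 * ((\<gamma> *\<^sub>R u t + t *\<^sub>R u' t) \<bullet> (\<gamma> *\<^sub>R u' t + (u' t + t *\<^sub>R u''))) / 2
             + (1 - p) * \<gamma> / 2 * (2 * (u t \<bullet> u' t))) * t powr (2 * p - 2)
       = t powr (2 * p - 1) * ((\<gamma> *\<^sub>R u t + t *\<^sub>R u' t) \<bullet> g)
              - (1 - p) * \<gamma> * (\<gamma> + 1 - p) * t powr (2 * p - 3) * (u t \<bullet> u t)"
      unfolding P P1 tu''
      by (simp add: inner_simps inner_commute[of "u' t" "u t"] field_simps)
  qed
qed

section \<open>Energy estimates along a trajectory\<close>

text \<open>The system in the parameters \<open>p\<close> and \<open>\<gamma>\<close>, with both
  equations valid at every \<open>t \<ge> T\<close>, two-sided derivatives and a continuous forcing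
  \<open>e\<close>. The saddle point enters through feasibility of \<open>xs\<close> and minimality
  of the Lagrangian in its first argument.\<close>

locale primal_dual_trajectory =
  fixes f :: "'a::real_inner \<Rightarrow> real" and gradf :: "'a \<Rightarrow> 'a"
    and A :: "'a \<Rightarrow> 'b::real_inner" and At :: "'b \<Rightarrow> 'a" and b :: 'b
    and T p \<gamma> \<mu> \<sigma> :: real
    and x x' x'' e :: "real \<Rightarrow> 'a" and lam lam' lam'' :: "real \<Rightarrow> 'b"
    and xs :: 'a and ls :: 'b
  assumes A: "bounded_linear A" and At: "\<And>z y. A z \<bullet> y = z \<bullet> At y"
    and f: "convex_on UNIV f" and gradf: "\<And>z. GDERIV f z :> gradf z"
    and T: "T > 0" and p: "p \<le> 1" and \<gamma>: "\<gamma> > 0" and \<mu>: "\<mu> > 0" and \<sigma>: "\<sigma> \<ge> 0"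
    and x': "\<And>t. t \<ge> T \<Longrightarrow> (x has_vector_derivative x' t) (at t)"
    and x'': "\<And>t. t \<ge> T \<Longrightarrow> (x' has_vector_derivative x'' t) (at t)"
    and lam': "\<And>t. t \<ge> T \<Longrightarrow> (lam has_vector_derivative lam' t) (at t)"
    and lam'': "\<And>t. t \<ge> T \<Longrightarrow> (lam' has_vector_derivative lam'' t) (at t)"
    and ode_x: "\<And>t. t \<ge> T \<Longrightarrow> x'' t + ((p + \<gamma>) / t) *\<^sub>R x' t =
        - ((\<mu> * t powr (\<gamma> - 2 * p)) *\<^sub>R (gradf (x t) + At (lam t + (t / \<gamma>) *\<^sub>R lam' t)
            + \<sigma> *\<^sub>R At (A (x t) - b))) + e t"
    and ode_lam: "\<And>t. t \<ge> T \<Longrightarrow> lam'' t + ((p + \<gamma>) / t) *\<^sub>R lam' t =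
        (\<mu> * t powr (\<gamma> - 2 * p)) *\<^sub>R (A (x t + (t / \<gamma>) *\<^sub>R x' t) - b)"
    and e_cont: "continuous_on {T..} e"
    and e_int: "(\<lambda>t. t powr p * norm (e t)) integrable_on {T..}"
    and feasible: "A xs = b" and minimal: "\<And>z. f xs \<le> f z + ls \<bullet> (A z - b)"
begin

text \<open>This is the Lagrangian at \<open>(x t, ls)\<close> minus its value at
  \<open>(xs, ls)\<close>, because \<open>A xs = b\<close>.\<close>

definition gap :: "real \<Rightarrow> real" where
  "gap t = f (x t) - f xs + ls \<bullet> (A (x t) - b)"

text \<open>The separate type variable \<open>'c\<close> lets one expression serve both the primal
  and the dual deviation.\<close>

definition oscillation :: "real \<Rightarrow> 'c::real_inner \<Rightarrow> 'c \<Rightarrow> real" where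
  "oscillation t u v =
     t powr (2 * p - 2) * ((norm (\<gamma> *\<^sub>R u + t *\<^sub>R v))\<^sup>2 / 2 + (1 - p) * \<gamma> / 2 * (norm u)\<^sup>2)"

definition energy :: "real \<Rightarrow> real" where
  "energy t = \<mu> * t powr \<gamma> * (gap t + \<sigma> / 2 * (norm (A (x t) - b))\<^sup>2)
     + (oscillation t (x t - xs) (x' t) + oscillation t (lam t - ls) (lam' t))"

lemma gap_nonneg: "gap t \<ge> 0"
  using minimal[of "x t"] by (simp add: gap_def)

lemma oscillation_nonneg: "oscillation t u v \<ge> 0"
  using p \<gamma> by (simp add: oscillation_def)

lemma gap_le_energy: "\<mu> * t powr \<gamma> * gap t \<le> energy t"
  using oscillation_nonneg[of t "x t - xs" "x' t"] oscillation_nonneg[of t "lam t - ls" "lam' t"] \<mu> \<sigma>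
  by (simp add: energy_def distrib_left)

lemma oscillation_le_energy:
  "oscillation t (x t - xs) (x' t) \<le> energy t" "oscillation t (lam t - ls) (lam' t) \<le> energy t"
proof -
  have "0 \<le> \<mu> * t powr \<gamma> * (gap t + \<sigma> / 2 * (norm (A (x t) - b))\<^sup>2)"
    using gap_nonneg[of t] \<mu> \<sigma> by (intro mult_nonneg_nonneg add_nonneg_nonneg) auto
  then show "oscillation t (x t - xs) (x' t) \<le> energy t" "oscillation t (lam t - ls) (lam' t) \<le> energy t"
    using oscillation_nonneg[of t "x t - xs" "x' t"] oscillation_nonneg[of t "lam t - ls" "lam' t"]
    unfolding energy_def by linarith+
qed

lemma energy_nonneg: "energy t \<ge> 0"
  using oscillation_nonneg oscillation_le_energy(1) order_trans by blast

text \<open>Each bound keeps one of the two squares in \<open>oscillation\<close> and drops the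
  other. At \<open>p = 1\<close> the second carries the factor 0 and gives no control of
  \<open>u\<close>.\<close>

lemma norm_le_of_oscillation:
  assumes "t > 0"
  shows "t powr (p - 1) * norm (\<gamma> *\<^sub>R u + t *\<^sub>R v) \<le> sqrt (2 * oscillation t u v)"
    and "sqrt ((1 - p) * \<gamma>) * (t powr (p - 1) * norm u) \<le> sqrt (2 * oscillation t u v)"
proof -
  have sq: "(t powr (p - 1))\<^sup>2 = t powr (2 * p - 2)"
    using assms by (simp add: power2_eq_square flip: powr_add)
  have "(t powr (p - 1) * norm (\<gamma> *\<^sub>R u + t *\<^sub>R v))\<^sup>2 \<le> 2 * oscillation t u v"
    using p \<gamma> unfolding power_mult_distrib sq oscillation_def by (simp add: distrib_left)
  then show "t powr (p - 1) * norm (\<gamma> *\<^sub>R u + t *\<^sub>R v) \<le> sqrt (2 * oscillation t u v)"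
    by (rule real_le_rsqrt)
  have "(sqrt ((1 - p) * \<gamma>) * (t powr (p - 1) * norm u))\<^sup>2 \<le> 2 * oscillation t u v"
    using p \<gamma> unfolding power_mult_distrib sq oscillation_def by (simp add: distrib_left)
  then show "sqrt ((1 - p) * \<gamma>) * (t powr (p - 1) * norm u) \<le> sqrt (2 * oscillation t u v)"
    by (rule real_le_rsqrt)
qed

text \<open>The derivative is computed exactly first. After all cancellations there remain a
  convexity term and a multiple of squared norms, both nonpositive, and the work
  \<open>y \<bullet> e t\<close>, which Cauchy-Schwarz bounds.\<close>

lemma energy_derivative:
  assumes t: "t \<ge> T"
  shows "\<exists>D. (energy has_real_derivative D) (at t) \<and> D \<le> t powr p * norm (e t) * sqrt (2 * energy t)"
proof -
  interpret A: bounded_linear A by (rule A)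
  have t0: "t > 0" using t T by linarith
  define u where "u = x t - xs"
  define v where "v = lam t - ls"
  define y where "y = \<gamma> *\<^sub>R u + t *\<^sub>R x' t"
  define z where "z = \<gamma> *\<^sub>R v + t *\<^sub>R lam' t"
  define G where "G = gradf (x t) + At (lam t + (t / \<gamma>) *\<^sub>R lam' t) + \<sigma> *\<^sub>R At (A (x t) - b)"
  define m where "m = \<mu> * t powr (\<gamma> - 2 * p)"
  have Au: "A (x t) - b = A u" by (simp add: u_def A.diff feasible)
  have ux: "((\<lambda>s. x s - xs) has_vector_derivative x' t) (at t)"
    using has_vector_derivative_diff[OF x'[OF t] has_vector_derivative_const[of xs]] by simp
  have vl: "((\<lambda>s. lam s - ls) has_vector_derivative lam' t) (at t)"
    using has_vector_derivative_diff[OF lam'[OF t] has_vector_derivative_const[of ls]] by simp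
  have eqx: "x'' t = - ((p + \<gamma>) / t) *\<^sub>R x' t + (e t - m *\<^sub>R G)"
    using ode_x[OF t] by (simp add: m_def G_def algebra_simps)
  have Ay: "A (x t + (t / \<gamma>) *\<^sub>R x' t) - b = (1 / \<gamma>) *\<^sub>R A y"
    using \<gamma> by (simp add: y_def A.add A.scaleR scaleR_add_right flip: Au)
  have eqlam: "lam'' t = - ((p + \<gamma>) / t) *\<^sub>R lam' t + (m / \<gamma>) *\<^sub>R A y"
    using ode_lam[OF t] unfolding Ay by (simp add: m_def algebra_simps)
  define D1 where "D1 = t powr (2 * p - 1) * (y \<bullet> (e t - m *\<^sub>R G))
              - (1 - p) * \<gamma> * (\<gamma> + 1 - p) * t powr (2 * p - 3) * (norm u)\<^sup>2"
  define D2 where "D2 = t powr (2 * p - 1) * (z \<bullet> ((m / \<gamma>) *\<^sub>R A y))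
              - (1 - p) * \<gamma> * (\<gamma> + 1 - p) * t powr (2 * p - 3) * (norm v)\<^sup>2"
  have d1: "((\<lambda>s. oscillation s (x s - xs) (x' s)) has_real_derivative D1) (at t)"
    unfolding oscillation_def D1_def y_def u_def
    by (rule damped_energy_derivative[OF t0 ux x''[OF t] eqx])
  have d2: "((\<lambda>s. oscillation s (lam s - ls) (lam' s)) has_real_derivative D2) (at t)"
    unfolding oscillation_def D2_def z_def v_def
    by (rule damped_energy_derivative[OF t0 vl lam''[OF t] eqlam])
  define L where "L = gap t + \<sigma> / 2 * (norm (A (x t) - b))\<^sup>2"
  \<comment> \<open>The gradient at \<open>x t\<close> of the augmented Lagrangian with multiplier
    fixed at \<open>ls\<close>.\<close>
  define gL where "gL = gradf (x t) + At ls + \<sigma> *\<^sub>R At (A u)"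
  have Ad: "((\<lambda>s. A (x s) - b) has_vector_derivative A (x' t)) (at t)"
    using has_vector_derivative_diff[OF A.has_vector_derivative[OF x'[OF t]] has_vector_derivative_const[of b]]
    by simp
  have fd: "((\<lambda>s. f (x s)) has_real_derivative x' t \<bullet> gradf (x t)) (at t)"
    using has_derivative_compose[OF x'[OF t, unfolded has_vector_derivative_def] gradf[unfolded gderiv_def]]
    unfolding has_field_derivative_def by (simp add: mult.commute[of _ "x' t \<bullet> gradf (x t)"])
  have d0: "((\<lambda>s. gap s + \<sigma> / 2 * (norm (A (x s) - b))\<^sup>2) has_real_derivative x' t \<bullet> gL) (at t)"
  proof -
    have "((\<lambda>s. gap s + \<sigma> / 2 * (norm (A (x s) - b))\<^sup>2) has_real_derivative
       (x' t \<bullet> gradf (x t) - 0 + ls \<bullet> A (x' t)) + \<sigma> / 2 * (2 * ((A (x t) - b) \<bullet> A (x' t)))) (at t)"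
      unfolding gap_def
    proof (intro DERIV_add DERIV_diff DERIV_cmult fd DERIV_const)
      show "((\<lambda>s. ls \<bullet> (A (x s) - b)) has_real_derivative ls \<bullet> A (x' t)) (at t)"
        using has_derivative_inner_right[OF Ad[unfolded has_vector_derivative_def], of ls]
        by (simp add: has_field_derivative_def mult.commute[of _ "ls \<bullet> A (x' t)"])
    qed (rule has_real_derivative_norm_power2[OF Ad])
    then show ?thesis
      by (rule DERIV_cong) (simp add: gL_def Au inner_simps inner_commute[of _ "A (x' t)"] At[symmetric])
  qed
  define D0 where "D0 = \<mu> * (\<gamma> * t powr (\<gamma> - 1)) * L + (x' t \<bullet> gL) * (\<mu> * t powr \<gamma>)"
  have dE: "(energy has_real_derivative D0 + (D1 + D2)) (at t)"
    unfolding energy_def[abs_def] D0_def L_def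
    by (intro DERIV_add DERIV_mult DERIV_cmult has_real_derivative_powr t0 d0 d1 d2)
  \<comment> \<open>The exponent \<open>\<gamma> - 2 * p\<close> of the scaling is used here: it
    matches the forcing weight in the oscillation terms with the derivative of
    \<open>t powr \<gamma>\<close>.\<close>
  define R where "R = t powr (\<gamma> - 1)"
  have R: "t powr \<gamma> = t * R" "t powr (2 * p - 1) * m = \<mu> * R"
    using t0 powr_mult_base[of t "\<gamma> - 1"] by (simp_all add: R_def m_def flip: powr_add)
  \<comment> \<open>The extrapolated multiplier minus \<open>ls\<close> equals \<open>z\<close>
    divided by \<open>\<gamma>\<close>, so the primal coupling term is the same number as the dual
    one and the two cancel.\<close>
  have "y \<bullet> G = y \<bullet> gL + A y \<bullet> (v + (t / \<gamma>) *\<^sub>R lam' t)"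
    by (simp add: G_def gL_def v_def Au inner_simps At[symmetric])
  also have "v + (t / \<gamma>) *\<^sub>R lam' t = (1 / \<gamma>) *\<^sub>R z"
    using \<gamma> by (simp add: z_def scaleR_add_right)
  finally have cross: "z \<bullet> ((1 / \<gamma>) *\<^sub>R A y) - y \<bullet> G = - (y \<bullet> gL)"
    by (simp add: inner_commute)
  \<comment> \<open>The tangent inequality handles \<open>f\<close>, the multiplier terms agree, and
    the penalty counts half on the left but fully on the right.\<close>
  have "L \<le> u \<bullet> gL"
  proof -
    have "f (x t) - u \<bullet> gradf (x t) \<le> f xs"
      using convex_on_GDERIV_le[OF f gradf, of "x t" xs] by (simp add: u_def inner_simps)
    moreover have "0 \<le> \<sigma> / 2 * (A u \<bullet> A u)" using \<sigma> by simp
    ultimately show ?thesis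
      unfolding L_def gap_def gL_def Au power2_norm_eq_inner
      by (simp add: inner_simps At[symmetric] inner_commute[of ls])
  qed
  then have descent: "\<mu> * R * \<gamma> * (L - u \<bullet> gL) \<le> 0"
    using \<mu> \<gamma> by (intro mult_nonneg_nonpos) (auto simp: R_def)
  \<comment> \<open>Since \<open>y = \<gamma> *\<^sub>R u + t *\<^sub>R x' t\<close>, the velocity
    part of \<open>y \<bullet> gL\<close> cancels against \<open>D0\<close>, and its
    \<open>u\<close> part joins the term with \<open>L\<close>.\<close>
  have "D0 + (D1 + D2) = \<mu> * R * \<gamma> * (L - u \<bullet> gL) + t powr (2 * p - 1) * (y \<bullet> e t)
      - (1 - p) * \<gamma> * (\<gamma> + 1 - p) * t powr (2 * p - 3) * ((norm u)\<^sup>2 + (norm v)\<^sup>2)"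
  proof -
    have "t powr (2 * p - 1) * (y \<bullet> (e t - m *\<^sub>R G)) + t powr (2 * p - 1) * (z \<bullet> ((m / \<gamma>) *\<^sub>R A y))
        = t powr (2 * p - 1) * (y \<bullet> e t) + (t powr (2 * p - 1) * m) * (z \<bullet> ((1 / \<gamma>) *\<^sub>R A y) - y \<bullet> G)"
      by (simp add: inner_simps algebra_simps)
    then have "D1 + D2 = t powr (2 * p - 1) * (y \<bullet> e t) - \<mu> * R * (y \<bullet> gL)
      - (1 - p) * \<gamma> * (\<gamma> + 1 - p) * t powr (2 * p - 3) * ((norm u)\<^sup>2 + (norm v)\<^sup>2)"
      unfolding cross R D1_def D2_def by (simp add: algebra_simps)
    then show ?thesis
      by (simp add: D0_def R R_def[symmetric] y_def inner_simps algebra_simps)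
  qed
  also have "\<dots> \<le> t powr (2 * p - 1) * (y \<bullet> e t)"
    using descent p \<gamma> by (smt (verit) mult_nonneg_nonneg powr_ge_zero zero_le_power2)
  also have "\<dots> \<le> t powr (2 * p - 1) * (norm y * norm (e t))"
    by (intro mult_left_mono norm_cauchy_schwarz) simp
  also have "\<dots> = t powr p * norm (e t) * (t powr (p - 1) * norm y)"
    by (simp flip: powr_add)
  also have "\<dots> \<le> t powr p * norm (e t) * sqrt (2 * energy t)"
    using norm_le_of_oscillation(1)[OF t0, of u "x' t"] oscillation_le_energy(1)[of t]
    unfolding y_def u_def
    by (intro mult_left_mono) (auto intro: order_trans)
  finally show ?thesis using dE by blast
qed

lemma energy_bounded: "\<exists>K. \<forall>t\<ge>T. energy t \<le> K"
proof -
  obtain E' where "\<And>t. t \<ge> T \<Longrightarrow> (energy has_real_derivative E' t) (at t)"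
    "\<And>t. t \<ge> T \<Longrightarrow> E' t \<le> t powr p * norm (e t) * sqrt (2 * energy t)"
    using energy_derivative by metis
  then show ?thesis
    by (rule bounded_of_deriv_le_sqrt[OF energy_nonneg])
       (use T in \<open>auto intro!: continuous_intros e_cont e_int\<close>)
qed

section \<open>Decay of the feasibility residual and of the objective error\<close>

text \<open>The penalty in the energy controls at best \<open>t powr \<gamma>\<close> times the
  squared residual, which is half the desired exponent. The full rate comes from the dual equation:
  multiplied by \<open>t powr (2 * p - 1)\<close>, its right-hand side is the exact derivative of
  \<open>(\<mu> / \<gamma> * t powr \<gamma>) *\<^sub>R (A (x t) - b)\<close>.\<close>

lemma residual_bounded: "\<exists>K. \<forall>t\<ge>T. t powr \<gamma> * norm (A (x t) - b) \<le> K"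
proof -
  interpret A: bounded_linear A by (rule A)
  obtain K where K: "\<And>t. t \<ge> T \<Longrightarrow> energy t \<le> K" using energy_bounded by blast
  define M where "M = sqrt (2 * K)"
  define v where "v t = lam t - ls" for t
  \<comment> \<open>With this constant the terms in \<open>lam'\<close> cancel in the derivative of
    \<open>Q\<close>, since \<open>2 * p - 1 + k = p + \<gamma>\<close>.\<close>
  define k where "k = \<gamma> + 1 - p"
  have k: "k > 0" using p \<gamma> by (simp add: k_def)
  have osc: "sqrt (2 * oscillation t (v t) (lam' t)) \<le> M" if "t \<ge> T" for t
    using oscillation_le_energy(2)[of t] K[OF that] by (simp add: M_def v_def)
  have w_le: "t powr (p - 1) * norm (\<gamma> *\<^sub>R v t + t *\<^sub>R lam' t) \<le> M"
    and v_le: "sqrt ((1 - p) * \<gamma>) * (t powr (p - 1) * norm (v t)) \<le> M" if "t \<ge> T" for t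
    using norm_le_of_oscillation[of t "v t" "lam' t"] osc[OF that] that T by linarith+
  \<comment> \<open>For \<open>p = 1\<close> this is a division by zero, so \<open>C = 0\<close>.
    The next bound survives because both of its sides carry the factor \<open>1 - p\<close>, the
    same factor that occurs in \<open>Q'\<close>.\<close>
  define C where "C = M / sqrt ((1 - p) * \<gamma>)"
  have v_le': "(1 - p) * (t powr (p - 1) * norm (v t)) \<le> (1 - p) * C" if "t \<ge> T" for t
  proof (cases "p = 1")
    case False
    then have "sqrt ((1 - p) * \<gamma>) > 0" using p \<gamma> by simp
    then have "t powr (p - 1) * norm (v t) \<le> C"
      using v_le[OF that] by (simp add: C_def pos_le_divide_eq mult.commute)
    then show ?thesis using p by (intro mult_left_mono) auto
  qed simp
  define Q where "Q t = (\<mu> / \<gamma> * t powr \<gamma>) *\<^sub>R (A (x t) - b)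
      - t powr (2 * p - 2) *\<^sub>R (k *\<^sub>R v t + t *\<^sub>R lam' t)" for t
  define Q' where "Q' t = (2 * (1 - p) * k * t powr (2 * p - 3)) *\<^sub>R v t" for t
  have Q': "(Q has_vector_derivative Q' t) (at t)" if t: "t \<ge> T" for t
  proof -
    have t0: "t > 0" using t T by linarith
    define P where "P = t powr (2 * p - 3)"
    have P: "t powr (2 * p - 2) = t * P"
      using t0 powr_mult_base[of t "2 * p - 3"] by (simp add: P_def)
    have P1: "t powr (2 * p - 2 - 1) = P" "t powr (2 * p - 3) = P" by (simp_all add: P_def)
    define R where "R = t powr (\<gamma> - 1)"
    define m where "m = \<mu> * t powr (\<gamma> - 2 * p)"
    define c where "c = \<mu> / \<gamma>"
    define r where "r = A (x t) - b"
    have "t * P * t = t powr (2 * p - 1)"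
      using t0 powr_mult_base[of t "2 * p - 2"] unfolding P by (simp add: mult.commute)
    then have "t * P * t * m = \<mu> * R" by (simp add: m_def R_def flip: powr_add)
    then have R: "t powr \<gamma> = t * R" "t * P * (t * m / \<gamma>) = c * R"
      using t0 powr_mult_base[of t "\<gamma> - 1"] by (simp_all add: R_def c_def mult_ac)
    have "t *\<^sub>R lam'' t = - (p + \<gamma>) *\<^sub>R lam' t + (t * m / \<gamma>) *\<^sub>R (\<gamma> *\<^sub>R r + t *\<^sub>R A (x' t))"
    proof -
      have g: "A (x t + (t / \<gamma>) *\<^sub>R x' t) - b = (1 / \<gamma>) *\<^sub>R (\<gamma> *\<^sub>R r + t *\<^sub>R A (x' t))"
        using \<gamma> by (simp add: r_def A.add A.scaleR scaleR_add_right)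
      have "lam'' t = - ((p + \<gamma>) / t) *\<^sub>R lam' t + m *\<^sub>R (1 / \<gamma>) *\<^sub>R (\<gamma> *\<^sub>R r + t *\<^sub>R A (x' t))"
        using ode_lam[OF t] unfolding g by (simp add: m_def algebra_simps)
      moreover have "t * - ((p + \<gamma>) / t) = - (p + \<gamma>)" "t * m * (1 / \<gamma>) = t * m / \<gamma>"
        using t0 by simp_all
      ultimately show ?thesis
        by (simp only: scaleR_add_right[of t "_ *\<^sub>R lam' t"] scaleR_scaleR mult.assoc[symmetric])
    qed
    then have forcing: "(t * P) *\<^sub>R (t *\<^sub>R lam'' t)
        = (t * P * - (p + \<gamma>)) *\<^sub>R lam' t + (c * R) *\<^sub>R (\<gamma> *\<^sub>R r + t *\<^sub>R A (x' t))"
      by (simp only: scaleR_add_right[of "t * P"] scaleR_scaleR R(2))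
    have rd: "((\<lambda>s. A (x s) - b) has_vector_derivative A (x' t)) (at t)"
      using has_vector_derivative_diff[OF A.has_vector_derivative[OF x'[OF t]] has_vector_derivative_const[of b]]
      by simp
    have vd: "(v has_vector_derivative lam' t) (at t)"
      using has_vector_derivative_diff[OF lam'[OF t] has_vector_derivative_const[of ls]]
      by (simp add: v_def[abs_def])
    have kvd: "((\<lambda>s. k *\<^sub>R v s) has_vector_derivative k *\<^sub>R lam' t) (at t)"
      using has_vector_derivative_scaleR[OF DERIV_const vd, of k] by simp
    define q where "q = p - 1"
    have q: "2 * p - 2 = q + q" "k = \<gamma> - q" "p + \<gamma> = q + 1 + \<gamma>" "2 * (1 - p) = - (q + q)"
      by (simp_all add: q_def k_def)
    have "(Q has_vector_derivative
        ((c * t powr \<gamma>) *\<^sub>R A (x' t) + (c * (\<gamma> * t powr (\<gamma> - 1))) *\<^sub>R r)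
        - (t powr (2 * p - 2) *\<^sub>R (k *\<^sub>R lam' t + (t *\<^sub>R lam'' t + 1 *\<^sub>R lam' t))
           + ((2 * p - 2) * t powr (2 * p - 2 - 1)) *\<^sub>R (k *\<^sub>R v t + t *\<^sub>R lam' t))) (at t)"
      unfolding Q_def[abs_def] r_def c_def
      by (intro has_vector_derivative_diff has_vector_derivative_scaleR has_vector_derivative_add
          DERIV_cmult has_real_derivative_powr t0 rd kvd lam''[OF t] DERIV_ident)
    moreover have "((c * t powr \<gamma>) *\<^sub>R A (x' t) + (c * (\<gamma> * t powr (\<gamma> - 1))) *\<^sub>R r)
        - (t powr (2 * p - 2) *\<^sub>R (k *\<^sub>R lam' t + (t *\<^sub>R lam'' t + 1 *\<^sub>R lam' t))
           + ((2 * p - 2) * t powr (2 * p - 2 - 1)) *\<^sub>R (k *\<^sub>R v t + t *\<^sub>R lam' t)) = Q' t"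
      unfolding Q'_def P P1 R(1) R_def[symmetric] scaleR_add_right[of "t * P"] forcing
      unfolding q by (simp add: algebra_simps) (simp flip: scaleR_2)
    ultimately show ?thesis by simp
  qed
  define B where "B = norm (Q T) + 2 * k * C * T powr (p - 1)"
  have C0: "C \<ge> 0"
    using w_le[of T] p \<gamma> by (auto simp: C_def intro!: divide_nonneg_nonneg order_trans[OF _ w_le[of T]])
  have Q_le: "norm (Q t) \<le> B" if t: "t \<ge> T" for t
  proof (cases "t = T")
    case True
    then show ?thesis using C0 k by (simp add: B_def)
  next
    case False
    \<comment> \<open>A primitive of the bound \<open>2 * k * (1 - p) * C * s powr (p - 2)\<close>
      on \<open>norm (Q' s)\<close>. The factor \<open>1 - p\<close> is absorbed by differentiation,
      so \<open>p = 1\<close> needs no separate logarithm; \<open>B\<close> is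
      \<open>norm (Q T) - \<phi> T\<close>.\<close>
    define \<phi> where "\<phi> s = - (2 * k * C) * s powr (p - 1)" for s
    define \<phi>' where "\<phi>' s = - (2 * k * C) * ((p - 1) * s powr (p - 1 - 1))" for s
    have d: "(\<phi> has_vector_derivative \<phi>' s) (at s)" if "s \<ge> T" for s
      unfolding \<phi>_def[abs_def] \<phi>'_def has_real_derivative_iff_has_vector_derivative[symmetric]
      using that T by (intro DERIV_cmult has_real_derivative_powr) simp
    have "norm (Q t - Q T) \<le> \<phi> t - \<phi> T"
    proof (rule differentiable_bound_general[of T t Q \<phi> Q' \<phi>'])
      show "T < t" using t False by simp
      show "continuous_on {T..t} Q"
        by (auto intro!: continuous_at_imp_continuous_on has_vector_derivative_continuous[OF Q'])
      show "continuous_on {T..t} \<phi>"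
        by (auto intro!: continuous_at_imp_continuous_on has_vector_derivative_continuous[OF d])
      fix s assume s: "T < s" "s < t"
      show "(Q has_vector_derivative Q' s) (at s)" "(\<phi> has_vector_derivative \<phi>' s) (at s)"
        using Q'[of s] d[of s] s by auto
      have "norm (Q' s) = 2 * k * s powr (p - 2) * ((1 - p) * (s powr (p - 1) * norm (v s)))"
      proof -
        have "s powr (2 * p - 3) = s powr (p - 2) * s powr (p - 1)" by (simp flip: powr_add)
        then show ?thesis using p k by (simp add: Q'_def abs_mult)
      qed
      also have "\<dots> \<le> 2 * k * s powr (p - 2) * ((1 - p) * C)"
        using s k by (intro mult_left_mono v_le') auto
      also have "\<dots> = \<phi>' s" by (simp add: \<phi>'_def algebra_simps)
      finally show "norm (Q' s) \<le> \<phi>' s" .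
    qed
    moreover have "\<phi> t \<le> 0" using C0 k by (simp add: \<phi>_def)
    moreover have "norm (Q t) \<le> norm (Q T) + norm (Q t - Q T)" by (rule norm_triangle_sub)
    moreover have "- \<phi> T = 2 * k * C * T powr (p - 1)" by (simp add: \<phi>_def)
    ultimately show ?thesis unfolding B_def by linarith
  qed
  have "t powr \<gamma> * norm (A (x t) - b) \<le> (B + T powr (p - 1) * (M + (1 - p) * C)) / (\<mu> / \<gamma>)"
    if t: "t \<ge> T" for t
  proof -
    \<comment> \<open>The part of \<open>Q\<close> to be removed. It is the vector controlled by the
      energy plus \<open>(1 - p) *\<^sub>R v t\<close>. One factor \<open>t powr (p - 1)\<close> is
      spent on that control, the other is at most its value at \<open>T\<close> because p \<le>
      1.\<close>
    define w where "w = k *\<^sub>R v t + t *\<^sub>R lam' t"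
    have "norm w \<le> norm (\<gamma> *\<^sub>R v t + t *\<^sub>R lam' t) + (1 - p) * norm (v t)"
    proof -
      have "w = (\<gamma> *\<^sub>R v t + t *\<^sub>R lam' t) + (1 - p) *\<^sub>R v t"
        by (simp add: w_def k_def algebra_simps)
      then show ?thesis using norm_triangle_ineq p by (metis abs_of_nonneg diff_ge_0_iff_ge norm_scaleR)
    qed
    then have "t powr (p - 1) * norm w \<le> t powr (p - 1) * (norm (\<gamma> *\<^sub>R v t + t *\<^sub>R lam' t) + (1 - p) * norm (v t))"
      by (intro mult_left_mono) auto
    also have "\<dots> \<le> M + (1 - p) * C"
      using w_le[OF t] v_le'[OF t] by (simp add: algebra_simps)
    finally have "t powr (p - 1) * norm w \<le> M + (1 - p) * C" .
    moreover have "t powr (p - 1) \<le> T powr (p - 1)"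
      using t T p by (intro powr_mono2') auto
    ultimately have "t powr (p - 1) * (t powr (p - 1) * norm w) \<le> T powr (p - 1) * (M + (1 - p) * C)"
      by (intro mult_mono) auto
    then have "norm (t powr (2 * p - 2) *\<^sub>R w) \<le> T powr (p - 1) * (M + (1 - p) * C)"
      by (simp flip: powr_add mult.assoc)
    moreover have "(\<mu> / \<gamma> * t powr \<gamma>) *\<^sub>R (A (x t) - b) = Q t + t powr (2 * p - 2) *\<^sub>R w"
      by (simp add: Q_def w_def)
    then have "norm ((\<mu> / \<gamma> * t powr \<gamma>) *\<^sub>R (A (x t) - b)) \<le> norm (Q t) + norm (t powr (2 * p - 2) *\<^sub>R w)"
      by (metis norm_triangle_ineq)
    ultimately have "norm ((\<mu> / \<gamma> * t powr \<gamma>) *\<^sub>R (A (x t) - b)) \<le> B + T powr (p - 1) * (M + (1 - p) * C)"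
      using Q_le[OF t] by linarith
    moreover have "norm ((\<mu> / \<gamma> * t powr \<gamma>) *\<^sub>R (A (x t) - b)) = t powr \<gamma> * norm (A (x t) - b) * (\<mu> / \<gamma>)"
      using \<mu> \<gamma> by (simp add: abs_mult)
    moreover have "\<mu> / \<gamma> > 0" using \<mu> \<gamma> by simp
    ultimately show ?thesis by (metis pos_le_divide_eq)
  qed
  then show ?thesis by blast
qed

text \<open>The objective error differs from \<open>gap\<close> by the pairing of \<open>ls\<close>
  with the residual, and both decay at rate \<open>\<gamma>\<close>.\<close>

lemma objective_bounded: "\<exists>K. \<forall>t\<ge>T. t powr \<gamma> * \<bar>f (x t) - f xs\<bar> \<le> K"
proof -
  obtain K where K: "\<And>t. t \<ge> T \<Longrightarrow> energy t \<le> K" using energy_bounded by blast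
  obtain N where N: "\<And>t. t \<ge> T \<Longrightarrow> t powr \<gamma> * norm (A (x t) - b) \<le> N"
    using residual_bounded by blast
  have "t powr \<gamma> * \<bar>f (x t) - f xs\<bar> \<le> K / \<mu> + norm ls * N" if t: "t \<ge> T" for t
  proof -
    have "\<bar>f (x t) - f xs\<bar> \<le> gap t + norm ls * norm (A (x t) - b)"
      using gap_nonneg[of t] Cauchy_Schwarz_ineq2[of ls "A (x t) - b"] unfolding gap_def by linarith
    then have "t powr \<gamma> * \<bar>f (x t) - f xs\<bar>
        \<le> t powr \<gamma> * (gap t + norm ls * norm (A (x t) - b))"
      by (intro mult_left_mono) auto
    also have "\<dots> = t powr \<gamma> * gap t + norm ls * (t powr \<gamma> * norm (A (x t) - b))"
      by (simp add: algebra_simps)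
    also have "t powr \<gamma> * gap t \<le> K / \<mu>"
      using gap_le_energy[of t] K[OF t] \<mu> by (simp add: pos_le_divide_eq mult_ac)
    also have "norm ls * (t powr \<gamma> * norm (A (x t) - b)) \<le> norm ls * N"
      using N[OF t] by (intro mult_left_mono) auto
    finally show ?thesis by simp
  qed
  then show ?thesis by blast
qed

end

section \<open>Passage from the almost everywhere system to the energy estimates\<close>

theorem theorem2p9:
  fixes f :: "'a::{real_inner, complete_space} \<Rightarrow> real"
    and gradf :: "'a \<Rightarrow> 'a"
    and A :: "'a \<Rightarrow> 'b::{real_inner, complete_space}"
    and b :: 'b
    and t0 \<sigma> \<mu> \<tau> \<alpha> \<delta> :: real
    and \<beta> :: "real \<Rightarrow> real"
    and \<epsilon> :: "real \<Rightarrow> 'a"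
    and x :: "real \<Rightarrow> 'a"
    and lam :: "real \<Rightarrow> 'b"
  assumes "bounded_linear A"
    and "convex_on UNIV f"
    and "\<And>z. GDERIV f z :> gradf z"
    and "continuous_on UNIV gradf"
    and "saddle_points f A b \<noteq> {}"
    and "t0 > 0" and "\<sigma> \<ge> 0" and "\<mu> > 0"
    and "0 \<le> \<tau>" and "\<tau> \<le> \<alpha>" and "\<alpha> \<le> 3" and "\<alpha> > 0"
    and "\<delta> = 3 / (2 * \<alpha> + \<tau>)"
    and "\<And>t. t \<ge> t0 \<Longrightarrow> \<beta> t = \<mu> * t powr \<tau>"
    and "set_integrable lebesgue {t0..} (\<lambda>t. t powr ((\<alpha> - \<tau>) / 3) * norm (\<epsilon> t))"
    and "global_solution t0 \<alpha> \<delta> \<sigma> \<beta> gradf A b \<epsilon> x lam"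
  shows "\<forall>(xs, ls) \<in> saddle_points f A b.
      (\<lambda>t. \<bar>f (x t) - f xs\<bar>) \<in> O[at_top](\<lambda>t. 1 / t powr ((2 * \<alpha> + \<tau>) / 3)) \<and>
      (\<lambda>t. norm (A (x t) - b)) \<in> O[at_top](\<lambda>t. 1 / t powr ((2 * \<alpha> + \<tau>) / 3))"
proof (intro ballI, clarify)
  fix xs ls assume saddle: "(xs, ls) \<in> saddle_points f A b"
  interpret A: bounded_linear A by fact
  interpret At: bounded_linear "adjoint A" by (rule bounded_linear_adjoint) fact
  define p where "p = (\<alpha> - \<tau>) / 3"
  define \<gamma> where "\<gamma> = (2 * \<alpha> + \<tau>) / 3"
  \<comment> \<open>Starting strictly after \<open>t0\<close> turns one-sided derivatives into
    two-sided ones; the asymptotic claim is unaffected.\<close>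
  define T where "T = t0 + 1"
  have \<gamma>: "\<gamma> > 0" and p: "p \<le> 1" and T: "T > 0"
    using assms by (auto simp: \<gamma>_def p_def T_def)
  have \<alpha>: "\<alpha> = p + \<gamma>" and \<tau>: "\<tau> = \<gamma> - 2 * p" and \<delta>: "\<delta> * t = t / \<gamma>" for t
    using assms(13) by (simp_all add: p_def \<gamma>_def field_simps)
  from \<open>global_solution t0 \<alpha> \<delta> \<sigma> \<beta> gradf A b \<epsilon> x lam\<close>
  obtain x' x'' lam' lam'' where C2x: "C2_on_with {t0..} x x' x''"
    and C2l: "C2_on_with {t0..} lam lam' lam''"
    and ae: "AE t in lebesgue_on {t0..}.
           x'' t + (\<alpha> / t) *\<^sub>R x' t =
             - (\<beta> t *\<^sub>R (gradf (x t) + adjoint A (lam t + (\<delta> * t) *\<^sub>R lam' t)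
                 + \<sigma> *\<^sub>R adjoint A (A (x t) - b))) + \<epsilon> t \<and>
           lam'' t + (\<alpha> / t) *\<^sub>R lam' t = \<beta> t *\<^sub>R (A (x t + (\<delta> * t) *\<^sub>R x' t) - b)"
    unfolding global_solution_def by blast
  define m where "m t = \<mu> * t powr (\<gamma> - 2 * p)" for t
  define G where "G t = gradf (x t) + adjoint A (lam t + (t / \<gamma>) *\<^sub>R lam' t)
      + \<sigma> *\<^sub>R adjoint A (A (x t) - b)" for t
  \<comment> \<open>The forcing read off from the \<open>C\<^sup>2\<close> trajectory is a continuous representative of \<open>\<epsilon>\<close>.\<close>
  define e where "e t = x'' t + ((p + \<gamma>) / t) *\<^sub>R x' t + m t *\<^sub>R G t" for t
  have meas: "{t0..} \<inter> space lebesgue \<in> sets lebesgue" by simp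
  have ae':
    "AE t in lebesgue. t \<in> {t0..} \<longrightarrow> e t = \<epsilon> t \<and>
    lam'' t + ((p + \<gamma>) / t) *\<^sub>R lam' t = m t *\<^sub>R (A (x t + (t / \<gamma>) *\<^sub>R x' t) - b)"
    using ae[unfolded AE_restrict_space_iff[OF meas]]
  proof (rule eventually_mono, intro impI)
    fix t assume *: "t \<in> {t0..} \<longrightarrow>
         x'' t + (\<alpha> / t) *\<^sub>R x' t =
           - (\<beta> t *\<^sub>R (gradf (x t) + adjoint A (lam t + (\<delta> * t) *\<^sub>R lam' t)
               + \<sigma> *\<^sub>R adjoint A (A (x t) - b))) + \<epsilon> t \<and>
         lam'' t + (\<alpha> / t) *\<^sub>R lam' t = \<beta> t *\<^sub>R (A (x t + (\<delta> * t) *\<^sub>R x' t) - b)"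
      and t: "t \<in> {t0..}"
    have "\<beta> t = m t" using assms(14) t by (simp add: m_def \<tau>)
    with * t show "e t = \<epsilon> t \<and>
        lam'' t + ((p + \<gamma>) / t) *\<^sub>R lam' t = m t *\<^sub>R (A (x t + (t / \<gamma>) *\<^sub>R x' t) - b)"
      unfolding \<delta> \<alpha>[symmetric] by (simp add: e_def G_def \<alpha>[symmetric])
  qed
  from ae' have ae_e: "AE t in lebesgue. t \<in> {t0..} \<longrightarrow> e t = \<epsilon> t"
    by (rule eventually_mono) simp
  from ae' have ae_lam: "AE t in lebesgue. t \<in> {t0<..} \<longrightarrow>
      lam'' t + ((p + \<gamma>) / t) *\<^sub>R lam' t = m t *\<^sub>R (A (x t + (t / \<gamma>) *\<^sub>R x' t) - b)"
    by (rule eventually_mono) simp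
  have deriv: "(g has_vector_derivative g' t) (at t)" "(g' has_vector_derivative g'' t) (at t)"
    if "C2_on_with {t0..} g g' g''" "t > t0" for g g' g'' :: "real \<Rightarrow> 'c::real_normed_vector" and t
    using that at_within_interior[of t "{t0..}"] by (auto simp: C2_on_with_def interior_Ici dest!: bspec[of _ _ t])
  have cont: "continuous_on {t0..} g" "continuous_on {t0..} g'" "continuous_on {t0..} g''"
    if "C2_on_with {t0..} g g' g''" for g g' g'' :: "real \<Rightarrow> 'c::real_normed_vector"
    using that unfolding C2_on_with_def continuous_on_eq_continuous_within
    by (auto intro: has_vector_derivative_continuous)
  note conts = cont[OF C2x] cont[OF C2l]
  have m_cont: "continuous_on {t0..} m"
    unfolding m_def using \<open>t0 > 0\<close> by (auto intro!: continuous_intros)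
  have grad_cont: "continuous_on {t0..} (\<lambda>t. gradf (x t))"
    using continuous_on_compose2[OF assms(4) conts(1)] by simp
  have e_cont: "continuous_on {t0..} e"
    unfolding e_def G_def using \<open>t0 > 0\<close> \<gamma>
    by (intro continuous_intros m_cont grad_cont conts A.continuous_on At.continuous_on) auto
  have ode_lam: "lam'' t + ((p + \<gamma>) / t) *\<^sub>R lam' t = m t *\<^sub>R (A (x t + (t / \<gamma>) *\<^sub>R x' t) - b)"
    if "t > t0" for t
  \<comment> \<open>The dual equation contains no forcing, so both sides are continuous and equality
    holds at every point.\<close>
  proof (rule AE_eq_continuous_on_open[OF ae_lam])
    have sub: "{t0<..} \<subseteq> {t0..}" by auto
    show "continuous_on {t0<..} (\<lambda>t. lam'' t + ((p + \<gamma>) / t) *\<^sub>R lam' t)"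
      using \<open>t0 > 0\<close> by (intro continuous_intros conts[THEN continuous_on_subset[OF _ sub]]) auto
    show "continuous_on {t0<..} (\<lambda>t. m t *\<^sub>R (A (x t + (t / \<gamma>) *\<^sub>R x' t) - b))"
      using \<gamma> by (intro continuous_intros conts[THEN continuous_on_subset[OF _ sub]] A.continuous_on
          m_cont[THEN continuous_on_subset[OF _ sub]]) auto
  qed (use that in auto)
  have "A xs = b"
  proof -
    \<comment> \<open>Moving the multiplier along the residual raises the Lagrangian by the squared
      norm of that residual, which maximality in the multiplier forbids unless it is zero.\<close>
    have "lagrangian f A b xs (ls + (A xs - b)) \<le> lagrangian f A b xs ls"
      using saddle by (auto simp: saddle_points_def)
    then have "(A xs - b) \<bullet> (A xs - b) \<le> 0" by (simp add: lagrangian_def inner_add_left)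
    then show ?thesis by (simp flip: power2_norm_eq_inner)
  qed
  moreover have "f xs \<le> f z + ls \<bullet> (A z - b)" for z
  proof -
    have "lagrangian f A b xs ls \<le> lagrangian f A b z ls"
      using saddle by (auto simp: saddle_points_def)
    then show ?thesis by (simp add: lagrangian_def \<open>A xs = b\<close>)
  qed
  moreover have "(\<lambda>t. t powr p * norm (e t)) integrable_on {T..}"
  proof -
    have "set_integrable lebesgue {T..} (\<lambda>t. t powr p * norm (\<epsilon> t))"
      using assms(15) unfolding p_def by (rule set_integrable_subset) (auto simp: T_def)
    then have int: "(\<lambda>t. t powr p * norm (\<epsilon> t)) integrable_on {T..}"
      by (rule set_lebesgue_integral_eq_integral)
    obtain N where N: "negligible N" "{t. \<not> (t \<in> {t0..} \<longrightarrow> e t = \<epsilon> t)} \<subseteq> N"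
      using ae_e unfolding eventually_ae_filter_negligible by blast
    have eq: "e t = \<epsilon> t" if "t \<in> {T..} - N" for t
      using that subsetD[OF N(2), of t] by (auto simp: T_def)
    show ?thesis
      by (rule integrable_spike[OF int N(1)]) (simp only: eq)
  qed
  \<comment> \<open>The primal equation is the definition of \<open>e\<close> rearranged, and the
    dual one is \<open>ode_lam\<close>.\<close>
  ultimately interpret primal_dual_trajectory f gradf A "adjoint A" b T p \<gamma> \<mu> \<sigma> x x' x'' e lam lam' lam'' xs ls
    using assms(1-3,7,8) adjoint_inner[OF assms(1)] T p \<gamma> deriv[OF C2x] deriv[OF C2l] ode_lam
      continuous_on_subset[OF e_cont, of "{T..}"]
    by unfold_locales (auto simp: T_def m_def e_def G_def)
  have bigo: "g \<in> O[at_top](\<lambda>t. 1 / t powr \<gamma>)"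
    if bd: "\<exists>K. \<forall>t\<ge>T. t powr \<gamma> * \<bar>g t\<bar> \<le> K" for g :: "real \<Rightarrow> real"
  proof -
    obtain K where K: "\<And>t. t \<ge> T \<Longrightarrow> t powr \<gamma> * \<bar>g t\<bar> \<le> K" using bd by blast
    have "norm (g t) \<le> K * norm (1 / t powr \<gamma>)" if "t \<ge> T" for t
      using K[OF that] that T by (simp add: field_simps)
    then show ?thesis
      by (intro bigoI[of _ K] eventually_mono[OF eventually_ge_at_top[of T]])
  qed
  show "(\<lambda>t. \<bar>f (x t) - f xs\<bar>) \<in> O[at_top](\<lambda>t. 1 / t powr ((2 * \<alpha> + \<tau>) / 3)) \<and>
      (\<lambda>t. norm (A (x t) - b)) \<in> O[at_top](\<lambda>t. 1 / t powr ((2 * \<alpha> + \<tau>) / 3))"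
    using bigo[of "\<lambda>t. \<bar>f (x t) - f xs\<bar>"] bigo[of "\<lambda>t. norm (A (x t) - b)"]
      objective_bounded residual_bounded by (simp add: \<gamma>_def)
qed

end
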